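(* Let $a\in(0,1)$ be fixed. Then, as $n\to\infty$, $$P_{2n}^D(2\lfloor an\rfloor)=-\frac{1}{\sqrt{\pi n^3a^3(1-a)^3}}+O\bigl(n^{-5/2}\bigr),$$ and consequently $$\lim_{n\to\infty}n^{3/2}P_{2n}^D(2\lfloor an\rfloor)=-\frac{1}{\sqrt{\pi a^3(1-a)^3}}.$$
   Context: A Dyck path of length $2n$ is a lattice path in $\mathbb{Z}^2$ from $(0,0)$ to $(2n,0)$ with steps $(1,1)$ and $(1,-1)$ that never goes below the line $Y=0$. Let $D_{2n}=\frac{1}{n+1}\binom{2n}{n}$ be the number of Dyck paths of length $2n$. For $0<N<n$, the pressure of Dyck paths of length $2n$ at the point $(2N,0)$ is the logarithm of the number of Dyck paths of length $2n$ avoiding $(2N,0)$ minus the logarithm of the number of all Dyck paths of length $2n$, that is, $$P_{2n}^D(2N)=\log\left(1-\frac{D_{2N}D_{2n-2N}}{D_{2n}}\right).$$ *)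

theory Defs
  imports Complex_Main "HOL-Library.Landau_Symbols" "HOL-Library.Product_Plus"
begin

text \<open>A lattice path is represented by the list of the points of \<open>\<int>\<times>\<int>\<close> that it visits,
  both endpoints included.  Every step increases the abscissa by one, so a path from \<open>(0, 0)\<close>
  to \<open>(m, 0)\<close> has exactly \<open>m\<close> steps.\<close>

definition dyck_paths :: "nat \<Rightarrow> (int \<times> int) list set" where
  "dyck_paths m = {p. p \<noteq> [] \<and> hd p = (0, 0) \<and> last p = (int m, 0) \<and>
     successively (\<lambda>u v. v - u \<in> {(1, 1), (1, -1)}) p \<and> (\<forall>(x, y) \<in> set p. y \<ge> 0)}"

definition dyck_pressure :: "nat \<Rightarrow> int \<Rightarrow> real" where
  "dyck_pressure m k =
     ln (real (card {p \<in> dyck_paths m. (k, 0) \<notin> set p})) - ln (real (card (dyck_paths m)))"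

end

(*
  Counting paths from (x, h) to the axis by the reflection principle gives the Catalan numbers,
  and cutting at (2N, 0) gives the factorised count of the paths through that point. By Wallis'
  product the squared normalised central binomial coefficients (binom(2n, n) / 4^n)^2 become
  monotone, with limit 1 / pi, after multiplication by n (increasing) or n + 1/2 (decreasing).
  Hence D_{2n} / 4^n lies between 1 / sqrt(pi (n+1)^3) and 1 / sqrt(pi n^3). With N = floor(a n)
  this encloses the pressure between two explicit functions of n with the same expansion up to
  O(n^{-5/2}).
*)
theory Submission
  imports Defs "HOL-Analysis.Gamma_Function" "HOL-Real_Asymp.Real_Asymp"
begin

subsection \<open>Counting nonnegative lattice paths\<close>

text \<open>The starting point is left free so that deleting the first step gives a path of the same
  kind, which makes induction on the length possible.\<close>

definition nonneg_paths :: "int \<Rightarrow> int \<Rightarrow> nat \<Rightarrow> (int \<times> int) list set" where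
  "nonneg_paths x h m = {p. p \<noteq> [] \<and> hd p = (x, h) \<and> last p = (x + int m, 0) \<and>
     successively (\<lambda>u v. v - u \<in> {(1, 1), (1, -1)}) p \<and> (\<forall>(x, y) \<in> set p. y \<ge> 0)}"

lemma dyck_paths_eq: "dyck_paths m = nonneg_paths 0 0 m"
  by (simp add: dyck_paths_def nonneg_paths_def)

text \<open>Each step raises the abscissa and the order on abscissas is transitive. Hence a path
  never returns to the abscissa of its starting point.\<close>

lemma abscissa_increasing:
  assumes "successively (\<lambda>u v. v - u \<in> {(1, 1), (1, -1)}) ((x, h) # q)" and "(v :: int \<times> int) \<in> set q"
  shows "x < fst v"
proof -
  have "successively (\<lambda>u v. fst u < fst v) ((x, h) # q)"
    by (rule successively_mono[OF assms(1)]) (auto simp: prod_eq_iff)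
  moreover have "transp (\<lambda>u v :: int \<times> int. fst u < fst v)"
    by (auto simp: transp_def)
  ultimately have "sorted_wrt (\<lambda>u v. fst u < fst v) ((x, h) # q)"
    by (simp only: successively_conv_sorted_wrt)
  with assms(2) show ?thesis by simp
qed

lemma nonneg_paths_0: "nonneg_paths x h 0 = (if h = 0 then {[(x, 0)]} else {})"
proof -
  have "p = [(x, h)] \<and> h = 0" if "p \<in> nonneg_paths x h 0" for p
  proof -
    from that obtain q where q: "p = (x, h) # q"
      by (cases p) (auto simp: nonneg_paths_def)
    have "q = []"
    proof (rule ccontr)
      assume "q \<noteq> []"
      then have "last p \<in> set q"
        using q by simp
      moreover have "fst (last p) = x"
        using that by (simp add: nonneg_paths_def)
      moreover have "successively (\<lambda>u v. v - u \<in> {(1, 1), (1, -1)}) ((x, h) # q)"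
        using that q by (simp add: nonneg_paths_def)
      ultimately show False
        by (metis abscissa_increasing less_irrefl)
    qed
    with q that show ?thesis by (simp add: nonneg_paths_def)
  qed
  moreover have "[(x, 0)] \<in> nonneg_paths x 0 0"
    by (simp add: nonneg_paths_def)
  ultimately show ?thesis by auto
qed

lemma nonneg_paths_neg: "h < 0 \<Longrightarrow> nonneg_paths x h m = {}"
  by (fastforce simp: nonneg_paths_def dest: hd_in_set)

text \<open>Split by the first step. For \<open>h = 0\<close> the second set is empty, since no path
  counted here starts below the axis.\<close>

lemma nonneg_paths_Suc:
  assumes "h \<ge> 0"
  shows "nonneg_paths x h (Suc m) =
    Cons (x, h) ` (nonneg_paths (x + 1) (h + 1) m \<union> nonneg_paths (x + 1) (h - 1) m)"
    (is "?L = ?R")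
proof (intro equalityI subsetI)
  fix p assume p: "p \<in> ?L"
  then obtain q where q: "p = (x, h) # q"
    by (cases p) (auto simp: nonneg_paths_def)
  have "q \<noteq> []"
    using p q by (auto simp: nonneg_paths_def)
  with p q have "hd q - (x, h) \<in> {(1, 1), (1, -1)}"
    by (auto simp: nonneg_paths_def successively_Cons)
  then have "hd q = (x + 1, h + 1) \<or> hd q = (x + 1, h - 1)"
    by (cases "hd q") auto
  with p q \<open>q \<noteq> []\<close> show "p \<in> ?R"
    by (auto simp: nonneg_paths_def successively_Cons add.assoc)
next
  fix p assume "p \<in> ?R"
  then show "p \<in> ?L"
    using assms by (auto simp: nonneg_paths_def successively_Cons add.assoc)
qed

lemma finite_nonneg_paths: "finite (nonneg_paths x h m)"
proof (induction m arbitrary: x h)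
  case 0
  show ?case by (simp add: nonneg_paths_0)
next
  case (Suc m)
  then show ?case
    by (cases "h < 0") (simp_all add: nonneg_paths_neg nonneg_paths_Suc)
qed

lemma nonneg_paths_disjoint:
  "h \<noteq> k \<Longrightarrow> nonneg_paths x h m \<inter> nonneg_paths x k m = {}"
  by (auto simp: nonneg_paths_def)

section \<open>Unconstrained walks and the reflection principle\<close>

text \<open>The number of unrestricted walks of \<open>m\<close> steps up or down by one from height
  \<open>j\<close> to height 0. Values are integers because reflection subtracts them.\<close>

fun walks :: "nat \<Rightarrow> int \<Rightarrow> int" where
  "walks 0 j = (if j = 0 then 1 else 0)"
| "walks (Suc m) j = walks m (j + 1) + walks m (j - 1)"

lemma walks_minus: "walks m (- j) = walks m j"
proof (induction m arbitrary: j)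
  case (Suc m)
  have "- j + 1 = - (j - 1)" "- j - 1 = - (j + 1)"
    by simp_all
  then show ?case
    by (simp only: walks.simps Suc add.commute)
qed simp

lemma walks_beyond: "int m < j \<Longrightarrow> walks m j = 0"
  by (induction m arbitrary: j) auto

text \<open>A walk from \<open>m - 2 * k\<close> down to 0 has exactly \<open>k\<close> up-steps;
  conditioning on the first step is Pascal's rule.\<close>

lemma walks_binomial: "walks m (int m - 2 * int k) = int (m choose k)"
proof (induction m arbitrary: k)
  case 0
  show ?case by (cases k) auto
next
  case (Suc m)
  show ?case
  proof (cases k)
    case 0
    then show ?thesis
      using Suc[of 0] by (simp add: walks_beyond)
  next
    case (Suc k')
    then show ?thesis
      using Suc.IH[of k] Suc.IH[of k'] by (simp add: algebra_simps)
  qed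
qed

text \<open>Reflection principle: the walks of length \<open>m\<close> from \<open>h\<close> to \<open>0\<close> that meet the line \<open>Y = -1\<close>
  correspond to the walks from \<open>-2 - h\<close> to \<open>0\<close>.\<close>
lemma card_nonneg_paths:
  "h \<ge> -1 \<Longrightarrow> int (card (nonneg_paths x h m)) = walks m h - walks m (h + 2)"
proof (induction m arbitrary: x h)
  case 0
  then show ?case by (simp add: nonneg_paths_0)
next
  case (Suc m)
  show ?case
  proof (cases "h < 0")
    case True
    then have "h = -1"
      using Suc.prems by simp
    then show ?thesis
      using walks_minus[of "Suc m" 1] by (simp add: nonneg_paths_neg del: walks.simps)
  next
    case False
    then have "card (nonneg_paths x h (Suc m)) =
        card (nonneg_paths (x + 1) (h + 1) m) + card (nonneg_paths (x + 1) (h - 1) m)"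
      by (simp add: nonneg_paths_Suc card_image card_Un_disjoint finite_nonneg_paths
          nonneg_paths_disjoint)
    then show ?thesis
      using False Suc.IH[of "h + 1" "x + 1"] Suc.IH[of "h - 1" "x + 1"]
      by (simp add: algebra_simps)
  qed
qed

section \<open>Paths through a prescribed point of the axis\<close>

lemma nonneg_paths_meet_start:
  assumes "p \<in> nonneg_paths x h m" and "(x, k) \<in> set p"
  shows "h = k"
proof -
  from assms(1) obtain q where q: "p = (x, h) # q"
    by (cases p) (auto simp: nonneg_paths_def)
  have "successively (\<lambda>u v. v - u \<in> {(1, 1), (1, -1)}) ((x, h) # q)"
    using assms(1) q by (simp add: nonneg_paths_def)
  from abscissa_increasing[OF this, of "(x, k)"] assms(2) q show ?thesis
    by auto
qed

lemma nonneg_paths_start: "p \<in> nonneg_paths x h m \<Longrightarrow> (x, h) \<in> set p"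
  by (auto simp: nonneg_paths_def dest: hd_in_set)

text \<open>Induction on the number \<open>j\<close> of steps before the marked point replaces an
  explicit cutting bijection: both sides satisfy the same first-step recurrence.\<close>

lemma card_nonneg_paths_through:
  "h \<ge> -1 \<Longrightarrow> card {p \<in> nonneg_paths x h (j + m). (x + int j, 0) \<in> set p} =
    card (nonneg_paths x h j) * card (nonneg_paths 0 0 m)"
proof (induction j arbitrary: x h)
  case 0
  show ?case
  proof (cases "h = 0")
    case True
    then have "{p \<in> nonneg_paths x h (0 + m). (x + int 0, 0) \<in> set p} = nonneg_paths x 0 m"
      using nonneg_paths_start by auto
    \<comment> \<open>Translation invariance is read off from the reflection formula, which does not
      involve \<open>x\<close>.\<close>
    moreover have "card (nonneg_paths x 0 m) = card (nonneg_paths 0 0 m)"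
      using card_nonneg_paths[of 0 x m] card_nonneg_paths[of 0 0 m] by simp
    ultimately show ?thesis
      using True by (simp add: nonneg_paths_0)
  next
    case False
    then have "{p \<in> nonneg_paths x h (0 + m). (x + int 0, 0) \<in> set p} = {}"
      using nonneg_paths_meet_start by auto
    with False show ?thesis
      by (simp only: nonneg_paths_0 if_False card.empty mult_0)
  qed
next
  case (Suc j)
  show ?case
  proof (cases "h < 0")
    case True
    then show ?thesis by (simp add: nonneg_paths_neg)
  next
    case False
    define A where "A k = nonneg_paths (x + 1) k (j + m)" for k
    define T where "T k = {p \<in> A k. (x + 1 + int j, 0) \<in> set p}" for k
    have fin: "finite (T k)" for k
      by (simp add: T_def A_def finite_nonneg_paths)
    have "{p \<in> nonneg_paths x h (Suc j + m). (x + int (Suc j), 0) \<in> set p} =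
        Cons (x, h) ` (T (h + 1) \<union> T (h - 1))"
      using False by (auto simp: nonneg_paths_Suc T_def A_def add.assoc)
    moreover have "T (h + 1) \<inter> T (h - 1) = {}"
      using nonneg_paths_disjoint[of "h + 1" "h - 1" "x + 1" "j + m"]
      by (auto simp: T_def A_def)
    ultimately have "card {p \<in> nonneg_paths x h (Suc j + m). (x + int (Suc j), 0) \<in> set p} =
        card (T (h + 1)) + card (T (h - 1))"
      by (simp add: card_image card_Un_disjoint fin)
    also have "\<dots> = (card (nonneg_paths (x + 1) (h + 1) j) +
        card (nonneg_paths (x + 1) (h - 1) j)) * card (nonneg_paths 0 0 m)"
      using False Suc.IH[of "h + 1" "x + 1"] Suc.IH[of "h - 1" "x + 1"]
      by (simp add: T_def A_def algebra_simps)
    also have "card (nonneg_paths (x + 1) (h + 1) j) + card (nonneg_paths (x + 1) (h - 1) j) =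
        card (nonneg_paths x h (Suc j))"
      using False by (simp add: nonneg_paths_Suc card_image card_Un_disjoint
          finite_nonneg_paths nonneg_paths_disjoint)
    finally show ?thesis .
  qed
qed

subsection \<open>Central binomial coefficients\<close>

text \<open>This ratio of neighbouring binomials turns the difference given by reflection into a
  Catalan number.\<close>

lemma central_binomial_pred:
  assumes "n = Suc k" shows "(n + 1) * ((2 * n) choose k) = n * ((2 * n) choose n)"
proof -
  have "(2 * n - k) * ((2 * n) choose k) = Suc k * ((2 * n) choose Suc k)"
    by (simp only: binomial_absorb_comp binomial_absorption)
  moreover have "2 * n - k = n + 1"
    using assms by simp
  ultimately show ?thesis
    by (simp only: assms)
qed

lemma central_binomial_Suc: "(n + 1) * (2 * Suc n choose Suc n) = 2 * (2 * n + 1) * (2 * n choose n)"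
proof -
  have "Suc n * (2 * Suc n choose Suc n) = 2 * Suc n * (2 * Suc n - 1 choose n)"
    by (rule binomial_absorption)
  also have "2 * Suc n - 1 = 2 * n + 1"
    by simp
  also have "2 * Suc n * (2 * n + 1 choose n) = 2 * ((2 * n + 1 - n) * (2 * n + 1 choose n))"
    by simp
  also have "(2 * n + 1 - n) * (2 * n + 1 choose n) = (2 * n + 1) * (2 * n choose n)"
    by (subst binomial_absorb_comp) simp
  finally show ?thesis
    by (simp only: Suc_eq_plus1 mult.assoc)
qed

section \<open>Wallis' product and bounds for central binomial coefficients\<close>

text \<open>Squaring makes the quotients of successive terms match the rational factors of Wallis'
  product and postpones square roots.\<close>

definition central :: "nat \<Rightarrow> real" where
  "central n = (real ((2 * n) choose n) / 4 ^ n)\<^sup>2"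

lemma central_Suc: "central (Suc n) = central n * ((2 * real n + 1) / (2 * real n + 2))\<^sup>2"
proof -
  define c d where "c = real (2 * n choose n)" and "d = real (2 * Suc n choose Suc n)"
  have "real ((n + 1) * (2 * Suc n choose Suc n)) = real (2 * (2 * n + 1) * (2 * n choose n))"
    by (simp only: central_binomial_Suc)
  then have "(real n + 1) * d = 2 * (2 * real n + 1) * c"
    unfolding c_def d_def by (simp only: of_nat_mult of_nat_add of_nat_1 of_nat_numeral)
  then have d: "d = 2 * (2 * real n + 1) * c / (real n + 1)"
    by (simp add: field_simps)
  have "d / 4 ^ Suc n = c / 4 ^ n * ((2 * real n + 1) / (2 * real n + 2))"
    unfolding d by (simp add: divide_simps) (simp add: algebra_simps)
  then show ?thesis
    by (simp only: central_def c_def d_def power_mult_distrib)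
qed

text \<open>The product telescopes: passing from \<open>n\<close> to \<open>n + 1\<close> divides
  \<open>(2 * n + 1) * central n\<close> by exactly the new Wallis factor.\<close>

lemma central_wallis: "(\<Prod>k=1..n. (4*real k^2) / (4*real k^2 - 1)) * ((2 * real n + 1) * central n) = 1"
proof (induction n)
  case 0
  show ?case by (simp add: central_def)
next
  case (Suc n)
  have *: "4 * real (Suc n)^2 - 1 = (2 * real n + 1) * (2 * real n + 3)"
    by (simp add: power2_eq_square algebra_simps)
  have "4 * real (Suc n)^2 / (4 * real (Suc n)^2 - 1) * ((2 * real (Suc n) + 1) * central (Suc n)) =
      (2 * real n + 1) * central n"
    unfolding * central_Suc
    by (simp add: divide_simps add_eq_0_iff2) (simp add: power2_eq_square algebra_simps)
  with Suc have "(\<Prod>k=1..n. (4*real k^2) / (4*real k^2 - 1)) *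
      (4 * real (Suc n)^2 / (4 * real (Suc n)^2 - 1) * ((2 * real (Suc n) + 1) * central (Suc n))) = 1"
    by (simp only:)
  then show ?case
    by (subst prod.nat_ivl_Suc') (simp_all only: mult.assoc mult.left_commute le_add2 Suc_eq_plus1)
qed

lemma central_limit: "(\<lambda>n. (2 * real n + 1) * central n) \<longlonglongrightarrow> 2 / pi"
proof -
  have "(\<lambda>n. inverse (\<Prod>k=1..n. (4*real k^2) / (4*real k^2 - 1))) \<longlonglongrightarrow> inverse (pi / 2)"
    by (intro tendsto_inverse wallis) simp
  moreover have "inverse (\<Prod>k=1..n. (4*real k^2) / (4*real k^2 - 1)) = (2 * real n + 1) * central n" for n
    using central_wallis[of n] by (rule inverse_unique)
  ultimately show ?thesis
    by (simp only: inverse_divide)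
qed

lemma central_pos: "central n > 0"
  by (simp add: central_def)

text \<open>The sequence decreases to its limit, since
  \<open>(2 * n + 1) * (2 * n + 3) <= (2 * n + 2)^2\<close>.\<close>

lemma central_lower: "2 / pi \<le> (2 * real n + 1) * central n"
proof (rule decseq_ge[OF _ central_limit])
  show "decseq (\<lambda>n. (2 * real n + 1) * central n)"
  proof (rule decseq_SucI)
    fix n
    have "(2 * real (Suc n) + 1) * ((2 * real n + 1) / (2 * real n + 2))\<^sup>2 \<le> 2 * real n + 1"
      by (simp add: divide_simps) (simp add: power2_eq_square algebra_simps)
    from mult_right_mono[OF this, of "central n"]
    show "(2 * real (Suc n) + 1) * central (Suc n) \<le> (2 * real n + 1) * central n"
      using central_pos[of n] by (simp add: central_Suc ac_simps)
  qed
qed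

text \<open>The sequence increases to its limit, since
  \<open>(2 * n + 1)^2 / (4 * (n + 1)) = n + 1 / (4 * (n + 1))\<close> is at least
  \<open>n\<close>.\<close>

lemma central_upper: "real n * central n \<le> 1 / pi"
proof (rule incseq_le)
  show "incseq (\<lambda>n. real n * central n)"
  proof (rule incseq_SucI)
    fix n
    have "real n \<le> real (Suc n) * ((2 * real n + 1) / (2 * real n + 2))\<^sup>2"
      by (simp add: divide_simps) (simp add: power2_eq_square algebra_simps)
    from mult_right_mono[OF this, of "central n"]
    show "real n * central n \<le> real (Suc n) * central (Suc n)"
      using central_pos[of n] by (simp add: central_Suc ac_simps)
  qed
  have "(\<lambda>n. real n / (2 * real n + 1) * ((2 * real n + 1) * central n)) \<longlonglongrightarrow> 1 / 2 * (2 / pi)"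
    by (intro tendsto_mult central_limit) real_asymp
  moreover have "real n / (2 * real n + 1) * ((2 * real n + 1) * central n) = real n * central n" for n
    by (simp add: add_eq_0_iff2 field_simps)
  ultimately show "(\<lambda>n. real n * central n) \<longlonglongrightarrow> 1 / pi"
    by simp
qed

subsection \<open>The proportion of Dyck paths through a point of the axis\<close>

lemma card_dyck_paths: "card (dyck_paths (2 * n)) * (n + 1) = (2 * n) choose n"
proof (cases n)
  case 0
  then show ?thesis by (simp add: dyck_paths_eq nonneg_paths_0)
next
  case (Suc k)
  \<comment> \<open>The heights 0 and 2 of the reflection formula are written as
    \<open>2 * n - 2 * n\<close> and \<open>2 * n - 2 * k\<close>, with \<open>n = k + 1\<close>, to
    fit \<open>walks_binomial\<close>.\<close>
  have "int (card (dyck_paths (2 * n))) = walks (2 * n) (int (2 * n) - 2 * int n) -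
      walks (2 * n) (int (2 * n) - 2 * int k)"
    using card_nonneg_paths[of 0 0 "2 * n"] Suc by (simp add: dyck_paths_eq del: walks.simps)
  then have "int (card (dyck_paths (2 * n))) = int ((2 * n) choose n) - int ((2 * n) choose k)"
    by (simp only: walks_binomial)
  then have "int (card (dyck_paths (2 * n)) * (n + 1)) =
      int (n + 1) * int ((2 * n) choose n) - int (n + 1) * int ((2 * n) choose k)"
    by (simp only: of_nat_mult right_diff_distrib mult.commute)
  also have "int (n + 1) * int ((2 * n) choose k) = int n * int ((2 * n) choose n)"
    using central_binomial_pred[OF Suc] by (metis of_nat_mult)
  finally have "int (card (dyck_paths (2 * n)) * (n + 1)) = int ((2 * n) choose n)"
    by (simp add: algebra_simps del: binomial_Suc_Suc)
  then show ?thesis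
    by (simp only: of_nat_eq_iff)
qed

text \<open>Scaling by the number of all walks of length \<open>2 * n\<close> removes the
  exponential growth and leaves a quantity of order \<open>n powr (-3/2)\<close>.\<close>

definition dyck_density :: "nat \<Rightarrow> real" where
  "dyck_density n = real (card (dyck_paths (2 * n))) / 4 ^ n"

lemma dyck_density_sq: "(dyck_density n)\<^sup>2 = central n / (real n + 1)\<^sup>2"
proof -
  have "real (card (dyck_paths (2 * n))) * (real n + 1) = real ((2 * n) choose n)"
    using card_dyck_paths[of n] by (metis of_nat_mult of_nat_add of_nat_1)
  then show ?thesis
    by (simp add: dyck_density_def central_def divide_simps flip: power_mult_distrib)
qed

lemma dyck_density_pos: "dyck_density n > 0"
proof -
  have "dyck_density n \<noteq> 0"
    using dyck_density_sq[of n] central_pos[of n] by auto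
  moreover have "dyck_density n \<ge> 0"
    by (simp add: dyck_density_def)
  ultimately show ?thesis by simp
qed

lemma dyck_density_sq_upper:
  assumes "n > 0"
  shows "(dyck_density n)\<^sup>2 \<le> 1 / (pi * real n ^ 3)"
proof -
  have "(dyck_density n)\<^sup>2 \<le> central n / (real n)\<^sup>2"
    unfolding dyck_density_sq using central_pos[of n] assms
    by (intro divide_left_mono) (auto intro!: power_mono)
  also have "\<dots> \<le> (1 / (pi * real n)) / (real n)\<^sup>2"
    using central_upper[of n] assms by (intro divide_right_mono) (auto simp: field_simps)
  finally show ?thesis
    by (simp add: power3_eq_cube power2_eq_square mult.assoc)
qed

lemma dyck_density_sq_lower: "1 / (pi * (real n + 1) ^ 3) \<le> (dyck_density n)\<^sup>2"
proof -
  \<comment> \<open>Weakening \<open>2 * n + 1\<close> to \<open>2 * n + 2\<close> makes the final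
    bound a pure cube of \<open>n + 1\<close>.\<close>
  have "2 / pi \<le> (2 * real n + 2) * central n"
    using central_lower[of n] central_pos[of n] by (simp add: algebra_simps)
  then have "1 / pi \<le> central n * (real n + 1)"
    by (simp add: algebra_simps)
  then have "1 / (pi * (real n + 1)) \<le> central n"
    by (simp add: pos_divide_le_eq flip: divide_divide_eq_left)
  then have "(1 / (pi * (real n + 1))) / (real n + 1)\<^sup>2 \<le> (dyck_density n)\<^sup>2"
    unfolding dyck_density_sq by (intro divide_right_mono) auto
  then show ?thesis
    by (simp add: power3_eq_cube power2_eq_square mult.assoc)
qed

text \<open>The proportion of Dyck paths of length \<open>2 * (N + M)\<close> that visit
  \<open>(2 * N, 0)\<close>: the powers of 4 cancel in the quotient.\<close>

definition dyck_through :: "nat \<Rightarrow> nat \<Rightarrow> real" where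
  "dyck_through N M = dyck_density N * dyck_density M / dyck_density (N + M)"

text \<open>The avoiding paths are the complement of those through the point. The hypothesis makes
  their proportion positive, so the logarithm of the product splits.\<close>

lemma dyck_pressure_eq:
  assumes "dyck_through N M < 1"
  shows "dyck_pressure (2 * (N + M)) (2 * int N) = ln (1 - dyck_through N M)"
proof -
  let ?D = "\<lambda>k. real (card (dyck_paths (2 * k)))"
  let ?S = "dyck_paths (2 * (N + M))"
  let ?T = "{p \<in> ?S. (2 * int N, 0) \<in> set p}"
  have fin: "finite ?S"
    by (simp add: dyck_paths_eq finite_nonneg_paths)
  have pos: "?D k > 0" for k
    using dyck_density_pos[of k] by (simp add: dyck_density_def zero_less_divide_iff)
  have T: "card ?T = card (dyck_paths (2 * N)) * card (dyck_paths (2 * M))"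
    using card_nonneg_paths_through[of 0 0 "2 * N" "2 * M"]
    by (simp add: dyck_paths_eq algebra_simps)
  have "{p \<in> ?S. (2 * int N, 0) \<notin> set p} = ?S - ?T"
    by auto
  then have "real (card {p \<in> ?S. (2 * int N, 0) \<notin> set p}) = ?D (N + M) - ?D N * ?D M"
    using fin card_mono[of ?S ?T] by (simp add: card_Diff_subset T[symmetric] of_nat_diff flip: of_nat_mult)
  also have "\<dots> = ?D (N + M) * (1 - dyck_through N M)"
    using pos[of "N + M"] by (simp add: dyck_through_def dyck_density_def field_simps power_add)
  finally show ?thesis
    using pos[of "N + M"] assms by (simp add: dyck_pressure_def ln_mult)
qed

text \<open>The density bounds are combined at the level of squares: upper bounds in the numerator,
  the lower bound in the denominator. \<open>dyck_through_lower\<close> swaps the roles.\<close>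

lemma dyck_through_upper:
  assumes "N > 0" "M > 0"
  shows "dyck_through N M \<le> sqrt ((real (N + M) + 1) ^ 3 / (pi * real N ^ 3 * real M ^ 3))"
proof (rule real_le_rsqrt)
  have "(dyck_through N M)\<^sup>2 = (dyck_density N)\<^sup>2 * (dyck_density M)\<^sup>2 / (dyck_density (N + M))\<^sup>2"
    by (simp add: dyck_through_def power_mult_distrib power_divide)
  also have "\<dots> \<le> 1 / (pi * real N ^ 3) * (1 / (pi * real M ^ 3)) / (1 / (pi * (real (N + M) + 1) ^ 3))"
    using assms dyck_density_sq_upper dyck_density_sq_lower[of "N + M"]
    by (intro frac_le mult_mono) auto
  also have "\<dots> = (real (N + M) + 1) ^ 3 / (pi * real N ^ 3 * real M ^ 3)"
    using assms by (simp add: field_simps)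
  finally show "(dyck_through N M)\<^sup>2 \<le> (real (N + M) + 1) ^ 3 / (pi * real N ^ 3 * real M ^ 3)" .
qed

lemma dyck_through_lower:
  assumes "N + M > 0"
  shows "sqrt (real (N + M) ^ 3 / (pi * (real N + 1) ^ 3 * (real M + 1) ^ 3)) \<le> dyck_through N M"
proof (rule real_le_lsqrt)
  have "real (N + M) ^ 3 / (pi * (real N + 1) ^ 3 * (real M + 1) ^ 3) =
      1 / (pi * (real N + 1) ^ 3) * (1 / (pi * (real M + 1) ^ 3)) / (1 / (pi * real (N + M) ^ 3))"
    using assms by (simp add: divide_simps)
  also have "\<dots> \<le> (dyck_density N)\<^sup>2 * (dyck_density M)\<^sup>2 / (dyck_density (N + M))\<^sup>2"
    using assms dyck_density_sq_upper[of "N + M"] dyck_density_sq_lower dyck_density_pos[of "N + M"]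
    by (intro frac_le mult_mono) auto
  also have "\<dots> = (dyck_through N M)\<^sup>2"
    by (simp add: dyck_through_def power_mult_distrib power_divide)
  finally show "real (N + M) ^ 3 / (pi * (real N + 1) ^ 3 * (real M + 1) ^ 3) \<le> (dyck_through N M)\<^sup>2" .
  show "0 \<le> dyck_through N M"
    using dyck_density_pos by (simp add: dyck_through_def less_imp_le)
qed

subsection \<open>Asymptotics of the pressure\<close>

lemma bigo_sandwich:
  fixes f l u :: "nat \<Rightarrow> real"
  assumes "eventually (\<lambda>n. l n \<le> f n \<and> f n \<le> u n) at_top" "l \<in> O(g)" "u \<in> O(g)"
  shows "f \<in> O(g)"
proof -
  have "f \<in> O(\<lambda>n. \<bar>l n\<bar> + \<bar>u n\<bar>)"
    by (rule bigoI[of _ 1]) (use assms(1) in \<open>eventually_elim, auto\<close>)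
  also have "(\<lambda>n. \<bar>l n\<bar> + \<bar>u n\<bar>) \<in> O(g)"
    using assms(2,3) by (intro sum_in_bigo) auto
  finally show ?thesis .
qed

text \<open>The constant shifts change the root by a relative \<open>O(1/n)\<close>, hence by
  \<open>O(n powr (-5/2))\<close>; the quadratic term of the logarithm is only of order
  \<open>1 / n^3\<close>.\<close>

lemma ln_lower_envelope_expansion:
  fixes K p :: real
  assumes "K > 0" "p > 0"
  shows "(\<lambda>n::nat. ln (1 - K * sqrt ((real n + 1) ^ 3 / ((real n - p) ^ 3 * real n ^ 3))) + K * real n powr (-3/2))
    \<in> O(\<lambda>n. real n powr (- 5 / 2))"
  using assms by real_asymp

lemma ln_upper_envelope_expansion:
  fixes K p q :: real
  assumes "K > 0" "p > 0" "q > 0"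
  shows "(\<lambda>n::nat. ln (1 - K * sqrt (real n ^ 3 / ((real n + p) ^ 3 * (real n + q) ^ 3))) + K * real n powr (-3/2))
    \<in> O(\<lambda>n. real n powr (- 5 / 2))"
  using assms by real_asymp

theorem mainTheorem2:
  fixes a :: real
  assumes "0 < a" and "a < 1"
  shows "((\<lambda>n::nat. dyck_pressure (2 * n) (2 * \<lfloor>a * real n\<rfloor>)
             - (- 1 / sqrt (pi * real n ^ 3 * a ^ 3 * (1 - a) ^ 3)))
           \<in> O(\<lambda>n. real n powr (- 5 / 2)))
       \<and> ((\<lambda>n::nat. real n powr (3 / 2) * dyck_pressure (2 * n) (2 * \<lfloor>a * real n\<rfloor>))
           \<longlonglongrightarrow> - 1 / sqrt (pi * a ^ 3 * (1 - a) ^ 3))"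
proof -
  define b where "b = 1 - a"
  define K where "K = 1 / sqrt (pi * a ^ 3 * b ^ 3)"
  define P where "P n = dyck_pressure (2 * n) (2 * \<lfloor>a * real n\<rfloor>)" for n
  \<comment> \<open>Here \<open>N\<close> lies between \<open>a * n - 1\<close> and
    \<open>a * n\<close>, and \<open>M\<close> between \<open>b * n\<close> and
    \<open>b * n + 1\<close>. Factoring out \<open>a\<close> and \<open>b\<close> gives the shifts
    \<open>1 / a\<close> and \<open>2 / b\<close>; in \<open>L\<close>, one unit of each shift
    before factoring comes from the density bound, and the second unit for \<open>M\<close> from
    rounding.\<close>
  define U where "U n = K * sqrt ((real n + 1) ^ 3 / ((real n - 1 / a) ^ 3 * real n ^ 3))" for n
  define L where "L n = K * sqrt (real n ^ 3 / ((real n + 1 / a) ^ 3 * (real n + 2 / b) ^ 3))" for n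
  have pos: "a > 0" "b > 0" "K > 0"
    using assms by (auto simp: b_def K_def)
  have "U \<longlonglongrightarrow> 0"
    unfolding U_def using pos by real_asymp
  then have "eventually (\<lambda>n. U n < 1) at_top"
    by (rule order_tendstoD) simp
  moreover have "eventually (\<lambda>n. real n > 1 / a) at_top"
    by real_asymp
  ultimately have bounds: "eventually (\<lambda>n. ln (1 - U n) \<le> P n \<and> P n \<le> ln (1 - L n)) at_top"
  proof eventually_elim
    case (elim n)
    define N where "N = nat \<lfloor>a * real n\<rfloor>"
    define M where "M = n - N"
    have "n > 0"
      using elim pos by (cases n) auto
    have "a * real n > 1"
      using elim pos by (simp add: field_simps)
    then have N_int: "int N = \<lfloor>a * real n\<rfloor>"
      by (simp add: N_def)
    then have N: "a * real n - 1 < real N" "real N \<le> a * real n"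
      by linarith+
    \<comment> \<open>This gives \<open>N <= n\<close>, so the natural-number subtraction defining
      \<open>M\<close> is not truncated.\<close>
    have "a * real n \<le> real n"
      using assms by (simp add: mult_left_le_one_le)
    with N(2) have NM: "n = N + M"
      by (simp add: M_def)
    have M: "b * real n \<le> real M" "real M < b * real n + 1"
      using N unfolding NM b_def by (simp_all add: algebra_simps)
    have "b * real n > 0"
      using pos \<open>n > 0\<close> by simp
    then have "N > 0" "M > 0"
      using N(1) \<open>a * real n > 1\<close> M(1) by linarith+
    have "dyck_through N M \<le> sqrt ((real n + 1) ^ 3 / (pi * real N ^ 3 * real M ^ 3))"
      using dyck_through_upper[OF \<open>N > 0\<close> \<open>M > 0\<close>] NM by simp
    also have "\<dots> \<le> sqrt ((real n + 1) ^ 3 / (pi * (a * real n - 1) ^ 3 * (b * real n) ^ 3))"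
      using N(1) M(1) \<open>a * real n > 1\<close> \<open>n > 0\<close> \<open>N > 0\<close> \<open>M > 0\<close> pos
      by (intro real_sqrt_le_mono divide_left_mono mult_mono power_mono mult_pos_pos) auto
    also have "pi * (a * real n - 1) ^ 3 * (b * real n) ^ 3 =
        (pi * a ^ 3 * b ^ 3) * ((real n - 1 / a) ^ 3 * real n ^ 3)"
    proof -
      have "a * real n - 1 = a * (real n - 1 / a)"
        using pos by (simp add: field_simps)
      then show ?thesis by (simp only: power_mult_distrib ac_simps)
    qed
    also have "sqrt ((real n + 1) ^ 3 / \<dots>) = U n"
      by (simp add: U_def K_def real_sqrt_mult real_sqrt_divide)
    finally have upper: "dyck_through N M \<le> U n" .

    have "L n = sqrt (real n ^ 3 / ((pi * a ^ 3 * b ^ 3) * ((real n + 1 / a) ^ 3 * (real n + 2 / b) ^ 3)))"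
      by (simp add: L_def K_def real_sqrt_mult real_sqrt_divide)
    also have "(pi * a ^ 3 * b ^ 3) * ((real n + 1 / a) ^ 3 * (real n + 2 / b) ^ 3) =
        pi * (a * real n + 1) ^ 3 * (b * real n + 2) ^ 3"
    proof -
      have "a * real n + 1 = a * (real n + 1 / a)" "b * real n + 2 = b * (real n + 2 / b)"
        using pos by (simp_all add: field_simps)
      then show ?thesis by (simp only: power_mult_distrib ac_simps)
    qed
    also have "sqrt (real n ^ 3 / \<dots>) \<le> sqrt (real n ^ 3 / (pi * (real N + 1) ^ 3 * (real M + 1) ^ 3))"
      using N(2) M(2) pos
      by (intro real_sqrt_le_mono divide_left_mono mult_mono power_mono mult_pos_pos) auto
    also have "\<dots> \<le> dyck_through N M"
      using dyck_through_lower[of N M] \<open>N > 0\<close> NM by simp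
    finally have lower: "L n \<le> dyck_through N M" .

    have "P n = ln (1 - dyck_through N M)"
      using dyck_pressure_eq[of N M] upper elim(1) by (simp add: P_def NM[symmetric] N_int)
    \<comment> \<open>Since \<open>1 - t\<close> reverses order, \<open>U\<close> bounds the
      pressure from below and \<open>L\<close> from above; \<open>U n < 1\<close> keeps all
      logarithms at positive arguments.\<close>
    with upper lower elim(1) show ?case by simp
  qed

  have main: "1 / sqrt (pi * real n ^ 3 * a ^ 3 * (1 - a) ^ 3) = K * real n powr (-3/2)" if "n > 0" for n
  proof -
    have "sqrt (real n ^ 3) = real n powr (3 / 2)"
      using that powr_powr[of "real n" 3 "1 / 2"] by (simp add: powr_half_sqrt)
    then show ?thesis
      by (simp add: K_def b_def real_sqrt_mult powr_minus_divide)
  qed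
  have error: "(\<lambda>n. P n + K * real n powr (-3/2)) \<in> O(\<lambda>n. real n powr (- 5 / 2))"
  proof (rule bigo_sandwich)
    show "eventually (\<lambda>n. ln (1 - U n) + K * real n powr (-3/2) \<le> P n + K * real n powr (-3/2) \<and>
        P n + K * real n powr (-3/2) \<le> ln (1 - L n) + K * real n powr (-3/2)) at_top"
      using bounds by eventually_elim auto
    show "(\<lambda>n. ln (1 - U n) + K * real n powr (-3/2)) \<in> O(\<lambda>n. real n powr (- 5 / 2))"
      unfolding U_def using pos by (intro ln_lower_envelope_expansion) auto
    show "(\<lambda>n. ln (1 - L n) + K * real n powr (-3/2)) \<in> O(\<lambda>n. real n powr (- 5 / 2))"
      unfolding L_def using pos by (intro ln_upper_envelope_expansion) auto
  qed
  have "(\<lambda>n. P n - (- 1 / sqrt (pi * real n ^ 3 * a ^ 3 * (1 - a) ^ 3))) \<in> O(\<lambda>n. real n powr (- 5 / 2))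
      \<longleftrightarrow> (\<lambda>n. P n + K * real n powr (-3/2)) \<in> O(\<lambda>n. real n powr (- 5 / 2))"
    by (intro landau_o.big.in_cong eventually_mono[OF eventually_gt_at_top[of 0]]) (simp add: main)
  moreover have "(\<lambda>n. real n powr (3 / 2) * P n) \<longlonglongrightarrow> - K"
  proof -
    \<comment> \<open>After multiplication by \<open>n powr (3/2)\<close> the error is
      \<open>O(1/n)\<close>, so it vanishes and only the constant \<open>- K\<close>
      remains.\<close>
    have "(\<lambda>n. real n powr (3/2) * (P n + K * real n powr (-3/2)))
        \<in> O(\<lambda>n. real n powr (3/2) * real n powr (- 5 / 2))"
      by (intro landau_o.big.mult_left error)
    also have "(\<lambda>n. real n powr (3/2) * real n powr (- 5 / 2)) \<in> o(\<lambda>_. 1)"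
      by real_asymp
    finally have "(\<lambda>n. real n powr (3/2) * (P n + K * real n powr (-3/2))) \<longlonglongrightarrow> 0"
      by (auto dest: smalloD_tendsto)
    then have "(\<lambda>n. real n powr (3/2) * (P n + K * real n powr (-3/2)) - K) \<longlonglongrightarrow> 0 - K"
      by (intro tendsto_diff tendsto_const)
    \<comment> \<open>The opposite powers cancel only for positive \<open>n\<close>, as
      \<open>0 powr x\<close> is 0.\<close>
    moreover have "eventually (\<lambda>n. real n powr (3/2) * (P n + K * real n powr (-3/2)) - K =
        real n powr (3/2) * P n) at_top"
      using eventually_gt_at_top[of 0]
    proof eventually_elim
      case (elim n)
      then have "real n powr (3/2) * real n powr (-3/2) = 1"
        by (simp flip: powr_add)
      then show ?case
        by (simp add: distrib_left mult.left_commute)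
    qed
    ultimately show ?thesis
      by (simp add: filterlim_cong)
  qed
  ultimately show ?thesis
    using error by (simp add: P_def K_def b_def)
qed

end
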